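(* Let $n\geq 0$ and $0<k<F_{n+2}$. Write $k-1=\sum_{i=2}^{n+1}u_iF_i$ and $k=\sum_{i=2}^{n+1}v_iF_i$ as Zeckendorf-Fibonacci expansions (padded with leading zeros to indices $2,\dots,n+1$), and let $j$ be the largest index with $u_j\neq v_j$. Then the $k$-th move of the unique optimal (minimal-length) solution of the Tower of Hanoi-Fibonacci with $n$ disks, going from $(\Delta_n,\varnothing,\varnothing)$ to $(\varnothing,\varnothing,\Delta_n)$, is a $(j-1)$-Fibonacci move.
   Context: Fibonacci numbers: $F_1=F_2=1$, $F_{m+2}=F_{m+1}+F_m$. Zeckendorf-Fibonacci expansion: every integer $m\geq 0$ is uniquely $\sum_{i\geq 2}u_iF_i$ with $u_i\in\{0,1\}$, finitely many nonzero, and $u_iu_{i+1}=0$ for all $i$. Disks $1,\dots,n$, $\Delta_k=\{1,\dots,k\}$ ($\varnothing$ for $k<1$). A state is an ordered triple $(A,B,C)$ of disjoint sets with union $\Delta_n$ (each peg stacked in decreasing order, top = minimum). For $k\in\Delta_n$, a $k$-Fibonacci move is defined when two distinct pegs $X,Y$ satisfy $X=k\tilde X$, $Y=\Delta_{k-1}\tilde Y$ (all disks of $\tilde X,\tilde Y$ larger than $k$) and the third peg $Z$ contains only disks larger than $k$; it yields $\tilde{X}\sqcup \Delta_{k-2}\tilde{Y}\sqcup (k-1)kZ$ (disks $k-1,k$ put simultaneously onto $Z$; peg positions preserved). The Tower of Hanoi-Fibonacci allows only such moves; its optimal solution from $(\Delta_n,\varnothing,\varnothing)$ to $(\varnothing,\varnothing,\Delta_n)$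 is unique and has $F_{n+2}-1$ moves. *)

theory Defs
  imports "HOL-Number_Theory.Fib"
begin

datatype peg = Peg_A | Peg_B | Peg_C

(* A state (A, B, C) is stored as the function sending each peg to its set of disks.
   A set suffices, since the disks of a peg are always stacked in decreasing order. *)
type_synonym state = "peg \<Rightarrow> nat set"

definition disks :: "nat \<Rightarrow> nat set" where
  "disks k = {1..k}"

definition is_state :: "nat \<Rightarrow> state \<Rightarrow> bool" where
  "is_state n s \<longleftrightarrow> (\<forall>p q. p \<noteq> q \<longrightarrow> s p \<inter> s q = {}) \<and> (\<Union>p. s p) = disks n"

definition all_on :: "nat \<Rightarrow> peg \<Rightarrow> state" where
  "all_on n p = (\<lambda>q. if q = p then disks n else {})"

(* The moved pair {k - 1, k} is intersected with disks k because for k = 1 there is no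
   disk k - 1: a 1-Fibonacci move moves disk 1 alone.  The truncated subtraction gives
   disks (k - 2) = {} for k = 1, as required. *)
definition fib_move :: "nat \<Rightarrow> nat \<Rightarrow> state \<Rightarrow> state \<Rightarrow> bool" where
  "fib_move n k s t \<longleftrightarrow> is_state n s \<and> k \<in> disks n \<and>
     (\<exists>X Y Z X' Y'. X \<noteq> Y \<and> X \<noteq> Z \<and> Y \<noteq> Z \<and>
        s X = {k} \<union> X' \<and> s Y = disks (k - 1) \<union> Y' \<and>
        (\<forall>d \<in> X' \<union> Y' \<union> s Z. k < d) \<and>
        t = s(X := X', Y := disks (k - 2) \<union> Y', Z := ({k - 1, k} \<inter> disks k) \<union> s Z))"

(* A solution is the list of successive states, initial state included: it has
   length ss - 1 moves, and its k-th move leads from ss ! (k - 1) to ss ! k. *)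
definition solution :: "nat \<Rightarrow> state list \<Rightarrow> bool" where
  "solution n ss \<longleftrightarrow> ss \<noteq> [] \<and> hd ss = all_on n Peg_A \<and> last ss = all_on n Peg_C \<and>
     (\<forall>i. Suc i < length ss \<longrightarrow> (\<exists>k. fib_move n k (ss ! i) (ss ! Suc i)))"

definition optimal_solution :: "nat \<Rightarrow> state list \<Rightarrow> bool" where
  "optimal_solution n ss \<longleftrightarrow> solution n ss \<and> (\<forall>ts. solution n ts \<longrightarrow> length ss \<le> length ts)"

(* m = (SUM i = 2..r. u i * F_i), padded with leading zeros up to index r; the values of u
   outside {2..r} are irrelevant. *)
definition zeckendorf :: "nat \<Rightarrow> (nat \<Rightarrow> nat) \<Rightarrow> nat \<Rightarrow> bool" where
  "zeckendorf r u m \<longleftrightarrow> (\<forall>i\<in>{2..r}. u i \<in> {0, 1}) \<and> (\<forall>i\<in>{2..<r}. u i * u (i + 1) = 0) \<and>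
     m = (\<Sum>i = 2..r. u i * fib i)"

end

(* The largest disk n has to move.  Just before its first move the tower of the n - 1 smaller
   disks has been carried to a single peg, and just after its last move the disks n - 1 and n lie
   on the target peg and the other n - 2 disks form a tower elsewhere.  So the moves of n are
   preceded by a transfer of n - 1 disks and followed by one of n - 2 disks, where the latter may
   in principle disturb disk n - 1; this detour is shown to be strictly too expensive.  Hence the
   optimal word of moves is W(n) = W(n-1) n W(n-2), of length F(n+2) - 1, and W(n) is unique.
   The letter of W(n) at position k is read off by the same recursion as the leading digits of
   the Zeckendorf expansions of k - 1 and k. *)
theory Submission
  imports Defs
begin

section \<open>Moves on configurations\<close>

(* A configuration maps each disk to its peg.  A move is a pair (k, z) of its index and its
   target peg; the index alone determines the target except for k = 1.  Disk 0 is a dummy: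
   a move with k = 1 also displaces it, and no legality condition looks at it. *)
type_synonym config = "nat \<Rightarrow> peg"

definition tower :: "config \<Rightarrow> nat \<Rightarrow> peg \<Rightarrow> bool" where
  "tower f m p \<longleftrightarrow> (\<forall>d. 0 < d \<and> d \<le> m \<longrightarrow> f d = p)"

text \<open>Having all smaller disks together on \<open>y\<close> is what keeps the source peg
  \<open>f k\<close> and the target \<open>z\<close> clear of them. For \<open>k = 1\<close> the
  tower is empty and both other pegs are possible targets.\<close>

definition legal :: "config \<Rightarrow> nat \<Rightarrow> peg \<Rightarrow> bool" where
  "legal f k z \<longleftrightarrow> 0 < k \<and> z \<noteq> f k \<and> (\<exists>y. y \<noteq> f k \<and> y \<noteq> z \<and> tower f (k - 1) y)"

definition move :: "nat \<Rightarrow> peg \<Rightarrow> config \<Rightarrow> config" where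
  "move k z f = f(k := z, k - 1 := z)"

text \<open>The bound \<open>m\<close> limits the indices, not the disks present: legality of a move
  only looks at disks up to its index, so a word on the \<open>m\<close> smallest disks can be run
  inside a larger puzzle.\<close>

fun valid :: "nat \<Rightarrow> config \<Rightarrow> (nat \<times> peg) list \<Rightarrow> bool" where
  "valid m f [] \<longleftrightarrow> True"
| "valid m f ((k, z) # ms) \<longleftrightarrow> k \<le> m \<and> legal f k z \<and> valid m (move k z f) ms"

fun run :: "config \<Rightarrow> (nat \<times> peg) list \<Rightarrow> config" where
  "run f [] = f"
| "run f ((k, z) # ms) = run (move k z f) ms"

fun trajectory :: "config \<Rightarrow> (nat \<times> peg) list \<Rightarrow> config list" where
  "trajectory f [] = [f]"
| "trajectory f ((k, z) # ms) = f # trajectory (move k z f) ms"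

definition third :: "peg \<Rightarrow> peg \<Rightarrow> peg" where
  "third p q = (if p \<noteq> Peg_A \<and> q \<noteq> Peg_A then Peg_A
     else if p \<noteq> Peg_B \<and> q \<noteq> Peg_B then Peg_B else Peg_C)"

fun transfer_word :: "nat \<Rightarrow> peg \<Rightarrow> peg \<Rightarrow> (nat \<times> peg) list" where
  "transfer_word 0 p q = []"
| "transfer_word (Suc 0) p q = [(1, q)]"
| "transfer_word (Suc (Suc m)) p q =
     transfer_word (Suc m) p (third p q) @ (Suc (Suc m), q) # transfer_word m (third p q) q"

lemma third_neq: "third p q \<noteq> p" "third p q \<noteq> q"
  by (cases p; cases q; simp add: third_def)+

lemma third_unique: "p \<noteq> q \<Longrightarrow> y \<noteq> p \<Longrightarrow> y \<noteq> q \<Longrightarrow> y = third p q"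
  by (cases p; cases q; cases y; simp add: third_def)

lemma tower_0 [simp]: "tower f 0 p"
  by (simp add: tower_def)

lemma tower_Suc: "tower f (Suc m) p \<longleftrightarrow> tower f m p \<and> f (Suc m) = p"
  by (auto simp: tower_def le_Suc_eq)

lemma move_Suc: "move (Suc m) z f (Suc m) = z" "move (Suc m) z f m = z"
  by (simp_all add: move_def)

text \<open>The base of the tower, disk m+1, travels with disk m+2, so a transfer of m+1 disks is
  followed by a task on only m disks. This is the source of the Fibonacci recursion.\<close>

lemma tower_move: "tower f (Suc m) y \<Longrightarrow> tower (move (Suc (Suc m)) z f) m y"
  by (auto simp: tower_def move_def)

section \<open>Composing and splitting words of moves\<close>

lemma valid_append: "valid m f (us @ vs) \<longleftrightarrow> valid m f us \<and> valid m (run f us) vs"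
  by (induction m f us rule: valid.induct) auto

lemma run_append: "run f (us @ vs) = run (run f us) vs"
  by (induction f us rule: run.induct) auto

lemma valid_mono: "valid m f ms \<Longrightarrow> m \<le> m' \<Longrightarrow> valid m' f ms"
  by (induction m f ms rule: valid.induct) auto

lemma valid_restrict:
  "valid (Suc m) f ms \<Longrightarrow> Suc m \<notin> fst ` set ms \<Longrightarrow> valid m f ms"
  by (induction "Suc m" f ms rule: valid.induct) auto

lemma valid_0: "valid 0 f ms \<Longrightarrow> ms = []"
  by (cases ms) (auto simp: legal_def)

lemma run_larger_disk: "valid m f ms \<Longrightarrow> m < d \<Longrightarrow> run f ms d = f d"
  by (induction m f ms rule: valid.induct) (auto simp: move_def)

text \<open>Only the indices m+1 and m+2 displace disk m+1, and the bound excludes the latter. Hence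
  this disk still lies on \<open>f (Suc m)\<close> when its index first occurs, and legality then
  forces the m smaller disks into a tower.\<close>

lemma split_first_move:
  assumes "valid (Suc m) f ms" and "Suc m \<in> fst ` set ms"
  obtains us z vs y where "ms = us @ (Suc m, z) # vs" "valid m f us"
    "z \<noteq> f (Suc m)" "y \<noteq> f (Suc m)" "y \<noteq> z" "tower (run f us) m y"
    "valid (Suc m) (move (Suc m) z (run f us)) vs"
proof -
  have "\<exists>x\<in>set ms. fst x = Suc m"
    using assms(2) by force
  then obtain us x vs where ms: "ms = us @ x # vs" "fst x = Suc m" "\<forall>y\<in>set us. fst y \<noteq> Suc m"
    by (rule split_list_first_propE)
  obtain z where x: "x = (Suc m, z)"
    using ms(2) by (cases x) auto
  have us: "valid m f us"
  proof (rule valid_restrict)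
    show "valid (Suc m) f us"
      using assms(1) ms(1) by (simp add: valid_append)
    show "Suc m \<notin> fst ` set us"
      using ms(3) by auto
  qed
  have leg: "legal (run f us) (Suc m) z" and vs: "valid (Suc m) (move (Suc m) z (run f us)) vs"
    using assms(1) ms(1) x by (simp_all add: valid_append)
  have same: "run f us (Suc m) = f (Suc m)"
    using us by (simp add: run_larger_disk)
  obtain y where "y \<noteq> f (Suc m)" "y \<noteq> z" "tower (run f us) m y"
    using leg unfolding legal_def same diff_Suc_1 by blast
  moreover have "z \<noteq> f (Suc m)"
    using leg unfolding legal_def same by blast
  ultimately show thesis
    using that[OF ms(1)[unfolded x] us] vs by blast
qed

text \<open>Counterpart at the other end: behind the last occurrence of index m+1 only smaller
  indices remain, so disk m+1 has reached its final peg \<open>z\<close>.\<close>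

lemma split_last_move:
  assumes "valid (Suc m) f ms" and "Suc m \<in> fst ` set ms"
  obtains us z vs y where "ms = us @ (Suc m, z) # vs"
    "y \<noteq> z" "tower (run f us) m y"
    "valid m (move (Suc m) z (run f us)) vs"
proof -
  have "\<exists>x\<in>set ms. fst x = Suc m"
    using assms(2) by force
  then obtain us x vs where ms: "ms = us @ x # vs" "fst x = Suc m" "\<forall>y\<in>set vs. fst y \<noteq> Suc m"
    by (rule split_list_last_propE)
  obtain z where x: "x = (Suc m, z)"
    using ms(2) by (cases x) auto
  have leg: "legal (run f us) (Suc m) z" and vs: "valid (Suc m) (move (Suc m) z (run f us)) vs"
    using assms(1) ms(1) x by (simp_all add: valid_append)
  obtain y where y: "y \<noteq> z" "tower (run f us) m y"
    using leg unfolding legal_def diff_Suc_1 by blast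
  have "Suc m \<notin> fst ` set vs"
    using ms(3) by auto
  with vs have "valid m (move (Suc m) z (run f us)) vs"
    by (rule valid_restrict)
  then show thesis
    using that[OF ms(1)[unfolded x] y] by blast
qed

section \<open>The optimal word\<close>

text \<open>Adding one counts states instead of moves and avoids the truncated subtraction in F(m+2)
  - 1; the bounds below use the same form.\<close>

lemma length_transfer_word: "Suc (length (transfer_word m p q)) = fib (m + 2)"
  by (induction m p q rule: transfer_word.induct) (simp_all add: add.commute)

lemma transfer_word_correct:
  "p \<noteq> q \<Longrightarrow> tower f m p \<Longrightarrow>
    valid m f (transfer_word m p q) \<and> tower (run f (transfer_word m p q)) m q"
proof (induction m p q arbitrary: f rule: transfer_word.induct)
  case (1 p q)
  then show ?case by simp
next
  case (2 p q)
  then show ?case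
    using third_neq[of p q] by (auto simp: legal_def tower_def move_def)
next
  case (3 m p q)
  let ?y = "third p q" and ?n = "Suc (Suc m)"
  let ?g = "run f (transfer_word (Suc m) p ?y)"
  let ?h = "move ?n q ?g"
  have g: "valid (Suc m) f (transfer_word (Suc m) p ?y)" "tower ?g (Suc m) ?y"
    using "3.IH"(1)[of f] "3.prems" third_neq[of p q] by (auto simp: tower_Suc)
  have "?g ?n = p"
    using run_larger_disk[OF g(1), of ?n] "3.prems" by (simp add: tower_Suc)
  then have leg: "legal ?g ?n q"
    using "3.prems" g(2) third_neq[of p q] by (auto simp: legal_def)
  have h: "valid m ?h (transfer_word m ?y q)" "tower (run ?h (transfer_word m ?y q)) m q"
    using "3.IH"(2)[of ?h] tower_move[OF g(2)] third_neq[of p q] by auto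
  have "tower (run ?h (transfer_word m ?y q)) ?n q"
    using h run_larger_disk[OF h(1)] by (simp add: tower_Suc move_Suc)
  then show ?case
    using g(1) leg h(1) by (auto simp: valid_append run_append intro: valid_mono)
qed

section \<open>Lower bounds and uniqueness by simultaneous induction\<close>

definition transfer_optimal :: "nat \<Rightarrow> bool" where
  "transfer_optimal m \<longleftrightarrow> (\<forall>f ms p q. valid m f ms \<longrightarrow> tower f m p \<longrightarrow> tower (run f ms) m q \<longrightarrow>
     p \<noteq> q \<longrightarrow> fib (m + 2) \<le> Suc (length ms) \<and>
       (Suc (length ms) = fib (m + 2) \<longrightarrow> ms = transfer_word m p q))"

text \<open>The task left over by a move of index m+2: disk m+1 already lies on the target
  \<open>q\<close>, the m smaller disks on \<open>p\<close>. Disk m+1 may be disturbed on the way,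
  yet the cost and the optimal word are those of a transfer of m disks.\<close>

definition gather_optimal :: "nat \<Rightarrow> bool" where
  "gather_optimal m \<longleftrightarrow> (\<forall>f ms p q. valid (Suc m) f ms \<longrightarrow> tower f m p \<longrightarrow> f (Suc m) = q \<longrightarrow>
     tower (run f ms) (Suc m) q \<longrightarrow>
     p \<noteq> q \<longrightarrow> fib (m + 2) \<le> Suc (length ms) \<and>
       (Suc (length ms) = fib (m + 2) \<longrightarrow> ms = transfer_word m p q))"

(* Gathering on another peg than that of disk m + 1 can be cheaper than transfer, hence the
   weaker bound. *)
definition gather_anywhere_bound :: "nat \<Rightarrow> bool" where
  "gather_anywhere_bound m \<longleftrightarrow> (\<forall>f ms p q r. valid (Suc m) f ms \<longrightarrow> tower f m p \<longrightarrow>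
     f (Suc m) = q \<longrightarrow> tower (run f ms) (Suc m) r \<longrightarrow> p \<noteq> q \<longrightarrow> fib (m + 1) \<le> Suc (length ms))"

text \<open>The last move of disk m+2 must end on \<open>q\<close> and takes disk m+1 there too,
  leaving a gathering task of at least F(m+2) - 1 moves. Together with that last move this makes
  F(m+2).\<close>

lemma gather_after_last_move:
  assumes "gather_optimal m" "valid (Suc (Suc m)) f ms" "Suc (Suc m) \<in> fst ` set ms"
    "tower (run f ms) (Suc (Suc m)) q"
  shows "fib (m + 2) \<le> length ms"
proof -
  let ?n = "Suc (Suc m)"
  obtain us z vs y where ms: "ms = us @ (?n, z) # vs" and yz: "y \<noteq> z"
    and tw: "tower (run f us) (Suc m) y" and vs: "valid (Suc m) (move ?n z (run f us)) vs"
    by (rule split_last_move[OF assms(2,3)])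
  let ?h = "move ?n z (run f us)"
  have end_pos: "tower (run ?h vs) ?n q"
    using assms(4) ms by (simp add: run_append)
  have "z = q"
    using end_pos run_larger_disk[OF vs, of ?n] by (simp add: tower_Suc move_Suc)
  then have "fib (m + 2) \<le> Suc (length vs)"
    using assms(1)[unfolded gather_optimal_def, rule_format, of ?h vs y q]
      vs tower_move[OF tw] end_pos yz by (simp add: tower_Suc move_Suc)
  then show ?thesis
    using ms by simp
qed

lemma transfer_optimal_0: "transfer_optimal 0"
  by (auto simp: transfer_optimal_def dest: valid_0)

lemma transfer_optimal_1: "transfer_optimal (Suc 0)"
  unfolding transfer_optimal_def
proof (intro allI impI)
  fix f ms p q
  assume *: "valid (Suc 0) f ms" "tower f (Suc 0) p" "tower (run f ms) (Suc 0) q" "p \<noteq> q"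
  then obtain k z vs where "ms = (k, z) # vs"
    by (cases ms) (auto simp: tower_def)
  moreover from this have "k = 1"
    using *(1) by (auto simp: legal_def)
  \<comment> \<open>The equality clause concerns only words with a single move, where the target is
    forced.\<close>
  moreover have "z = q" if "vs = []"
    using *(3) calculation that by (simp add: tower_Suc move_def)
  ultimately show "fib (Suc 0 + 2) \<le> Suc (length ms) \<and>
      (Suc (length ms) = fib (Suc 0 + 2) \<longrightarrow> ms = transfer_word (Suc 0) p q)"
    by (simp add: numeral_2_eq_2)
qed

lemma gather_optimal_0: "gather_optimal 0"
  by (auto simp: gather_optimal_def)

text \<open>If disk m+2 stays put, the task is a transfer of m+1 disks. Otherwise it leaves
  \<open>q\<close> and has to come back, and two moves of it already exceed the bound.\<close>

lemma gather_optimal_Suc: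
  assumes "transfer_optimal (Suc m)" "gather_optimal m" "gather_anywhere_bound m"
  shows "gather_optimal (Suc m)"
  unfolding gather_optimal_def
proof (intro allI impI)
  fix f ms p q
  let ?n = "Suc (Suc m)"
  assume val: "valid ?n f ms" and start: "tower f (Suc m) p" "f ?n = q"
    and fin: "tower (run f ms) ?n q" and pq: "p \<noteq> q"
  show "fib (Suc m + 2) \<le> Suc (length ms) \<and>
      (Suc (length ms) = fib (Suc m + 2) \<longrightarrow> ms = transfer_word (Suc m) p q)"
  proof (cases "?n \<in> fst ` set ms")
    case False
    then have "valid (Suc m) f ms"
      using val valid_restrict by blast
    moreover have "tower (run f ms) (Suc m) q"
      using fin by (simp add: tower_Suc)
    ultimately show ?thesis
      using assms(1) start(1) pq unfolding transfer_optimal_def by blast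
  next
    case True
    obtain us z vs y where ms: "ms = us @ (?n, z) # vs" and us: "valid (Suc m) f us"
      and zy: "z \<noteq> f ?n" "y \<noteq> f ?n" "y \<noteq> z" and tw: "tower (run f us) (Suc m) y"
      and vs: "valid ?n (move ?n z (run f us)) vs"
      by (rule split_first_move[OF val True])
    let ?h = "move ?n z (run f us)"
    have end_pos: "tower (run ?h vs) ?n q"
      using fin ms by (simp add: run_append)
    have again: "?n \<in> fst ` set vs"
    proof (rule ccontr)
      assume "?n \<notin> fst ` set vs"
      then have "valid (Suc m) ?h vs"
        using vs valid_restrict by blast
      then have "run ?h vs ?n = z"
        by (simp add: run_larger_disk move_Suc)
      then show False
        using end_pos zy(1) start(2) by (simp add: tower_Suc)
    qed
    obtain us' z' vs' y' where vs_eq: "vs = us' @ (?n, z') # vs'" and us': "valid (Suc m) ?h us'"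
      and "z' \<noteq> ?h ?n" "y' \<noteq> ?h ?n" "y' \<noteq> z'" and tw': "tower (run ?h us') (Suc m) y'"
      and "valid ?n (move ?n z' (run ?h us')) vs'"
      by (rule split_first_move[OF vs again])
    \<comment> \<open>The prefix \<open>us\<close> may be empty, since \<open>y = p\<close> is
      possible. The excess comes from the first move of disk m+2, at least F(m+1) - 1 moves before
      the second, and F(m+2) from the second on: F(m+3) in total, one more than allowed.\<close>
    have "fib (m + 1) \<le> Suc (length us')"
      using assms(3)[unfolded gather_anywhere_bound_def, rule_format, of ?h us' y z y']
        us' tower_move[OF tw] tw' zy by (simp add: move_Suc)
    moreover have "fib (m + 2) \<le> length ((?n, z') # vs')"
    proof (rule gather_after_last_move[OF assms(2)])
      show "valid ?n (run ?h us') ((?n, z') # vs')"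
        using vs unfolding vs_eq valid_append by blast
      show "tower (run (run ?h us') ((?n, z') # vs')) ?n q"
        using end_pos unfolding vs_eq run_append .
    qed simp
    ultimately have "fib (Suc m + 2) < Suc (length ms)"
      using ms vs_eq by simp
    then show ?thesis
      by simp
  qed
qed

lemma gather_anywhere_bound_0: "gather_anywhere_bound 0"
  by (simp add: gather_anywhere_bound_def)

text \<open>If disk m+2 moves, its last move and what follows already cost F(m+2). If it does not
  move, the gathering peg is \<open>q\<close> and the stronger bound applies.\<close>

lemma gather_anywhere_bound_Suc:
  assumes "gather_optimal m" "gather_optimal (Suc m)"
  shows "gather_anywhere_bound (Suc m)"
  unfolding gather_anywhere_bound_def
proof (intro allI impI)
  fix f ms p q r
  let ?n = "Suc (Suc m)"
  assume val: "valid ?n f ms" and start: "tower f (Suc m) p" "f ?n = q"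
    and fin: "tower (run f ms) ?n r" and pq: "p \<noteq> q"
  show "fib (Suc m + 1) \<le> Suc (length ms)"
  proof (cases "?n \<in> fst ` set ms")
    case True
    then show ?thesis
      using gather_after_last_move[OF assms(1) val _ fin] by simp
  next
    case False
    then have "valid (Suc m) f ms"
      using val valid_restrict by blast
    then have "run f ms ?n = q"
      using start(2) by (simp add: run_larger_disk)
    then have "r = q"
      using fin by (simp add: tower_Suc)
    then have "fib (Suc m + 2) \<le> Suc (length ms)"
      using assms(2) val start fin pq unfolding gather_optimal_def by blast
    then show ?thesis
      by simp
  qed
qed

text \<open>The word up to and including the first move of disk m+2 costs at least F(m+3) moves. A
  second move of that disk adds F(m+2), which is too much; with a single move the rest is a
  gathering task. The bounds of the two phases add up exactly, so equality overall forces equality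
  in each.\<close>

lemma transfer_optimal_Suc_Suc:
  assumes "transfer_optimal (Suc m)" "gather_optimal m"
  shows "transfer_optimal (Suc (Suc m))"
  unfolding transfer_optimal_def
proof (intro allI impI)
  fix f ms p q
  let ?n = "Suc (Suc m)"
  assume val: "valid ?n f ms" and start: "tower f ?n p"
    and fin: "tower (run f ms) ?n q" and pq: "p \<noteq> q"
  have moved: "?n \<in> fst ` set ms"
  proof (rule ccontr)
    assume "?n \<notin> fst ` set ms"
    then have "valid (Suc m) f ms"
      using val valid_restrict by blast
    then have "run f ms ?n = f ?n"
      by (simp add: run_larger_disk)
    then show False
      using start fin pq by (simp add: tower_Suc)
  qed
  obtain us z vs y where ms: "ms = us @ (?n, z) # vs" and us: "valid (Suc m) f us"
      and zy: "z \<noteq> f ?n" "y \<noteq> f ?n" "y \<noteq> z" and tw: "tower (run f us) (Suc m) y"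
      and vs: "valid ?n (move ?n z (run f us)) vs"
    by (rule split_first_move[OF val moved])
  let ?h = "move ?n z (run f us)"
  have end_pos: "tower (run ?h vs) ?n q"
    using fin ms by (simp add: run_append)
  have fn: "f ?n = p"
    using start by (simp add: tower_Suc)
  have len_us: "fib (Suc m + 2) \<le> Suc (length us)"
    and eq_us: "Suc (length us) = fib (Suc m + 2) \<Longrightarrow> us = transfer_word (Suc m) p y"
    using assms(1)[unfolded transfer_optimal_def, rule_format, of f us p y]
      us start tw zy fn by (auto simp: tower_Suc)
  show "fib (?n + 2) \<le> Suc (length ms) \<and>
      (Suc (length ms) = fib (?n + 2) \<longrightarrow> ms = transfer_word ?n p q)"
  proof (cases "?n \<in> fst ` set vs")
    case True
    have "fib (m + 2) \<le> length vs"
      by (rule gather_after_last_move[OF assms(2) vs True end_pos])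
    then have "fib (?n + 2) < Suc (length ms)"
      using len_us ms by simp
    then show ?thesis
      by simp
  next
    case False
    then have vs': "valid (Suc m) ?h vs"
      using vs valid_restrict by blast
    have z: "z = q"
      using run_larger_disk[OF vs', of ?n] end_pos by (simp add: tower_Suc move_Suc)
    have y: "y = third p q"
      using zy z fn pq third_unique by metis
    have "fib (m + 2) \<le> Suc (length vs)"
      and "Suc (length vs) = fib (m + 2) \<Longrightarrow> vs = transfer_word m y q"
      using assms(2)[unfolded gather_optimal_def, rule_format, of ?h vs y q]
        vs' tower_move[OF tw] end_pos zy z by (auto simp: tower_Suc move_Suc)
    then show ?thesis
      using len_us eq_us ms y z by auto
  qed
qed

text \<open>Transfer runs one index ahead, because gathering m+2 disks without moving the largest is
  a transfer of m+1 disks.\<close>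

lemma all_optimal: "transfer_optimal (Suc m) \<and> gather_optimal m \<and> gather_anywhere_bound m"
proof (induction m)
  case 0
  show ?case
    using transfer_optimal_1 gather_optimal_0 gather_anywhere_bound_0 by blast
next
  case (Suc m)
  then show ?case
    using transfer_optimal_Suc_Suc gather_optimal_Suc gather_anywhere_bound_Suc by blast
qed

lemma transfer_word_optimal:
  assumes "valid m f ms" "tower f m p" "tower (run f ms) m q" "p \<noteq> q"
  shows "fib (m + 2) \<le> Suc (length ms)"
    and "Suc (length ms) = fib (m + 2) \<Longrightarrow> ms = transfer_word m p q"
proof -
  have "transfer_optimal m"
    using transfer_optimal_0 all_optimal by (cases m) auto
  then show "fib (m + 2) \<le> Suc (length ms)"
    and "Suc (length ms) = fib (m + 2) \<Longrightarrow> ms = transfer_word m p q"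
    using assms unfolding transfer_optimal_def by blast+
qed

section \<open>Zeckendorf expansions\<close>

text \<open>Peels off the leading digit. The inequality on the right guards the truncated
  subtraction.\<close>

lemma zeckendorf_Suc:
  assumes "0 < r"
  shows "zeckendorf (Suc r) u m \<longleftrightarrow> u (Suc r) \<in> {0, 1} \<and> (2 \<le> r \<longrightarrow> u r * u (Suc r) = 0) \<and>
    u (Suc r) * fib (Suc r) \<le> m \<and> zeckendorf r u (m - u (Suc r) * fib (Suc r))"
proof -
  let ?a = "u (Suc r) * fib (Suc r)" and ?s = "\<Sum>i = 2..r. u i * fib i"
  have digits: "(\<forall>i\<in>{2..Suc r}. u i \<in> {0, 1}) \<longleftrightarrow>
      u (Suc r) \<in> {0, 1} \<and> (\<forall>i\<in>{2..r}. u i \<in> {0, 1})"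
    using assms by (subst atLeastAtMostSuc_conv) (simp_all only: ball_simps)
  have products: "(\<forall>i\<in>{2..<Suc r}. u i * u (i + 1) = 0) \<longleftrightarrow>
      (2 \<le> r \<longrightarrow> u r * u (Suc r) = 0) \<and> (\<forall>i\<in>{2..<r}. u i * u (i + 1) = 0)"
    by (cases "2 \<le> r") (simp_all only: atLeastLessThanSuc ball_simps if_True simp_thms, simp_all)
  have "(\<Sum>i = 2..Suc r. u i * fib i) = ?s + ?a"
    using assms by simp
  then have total: "m = (\<Sum>i = 2..Suc r. u i * fib i) \<longleftrightarrow> ?a \<le> m \<and> m - ?a = ?s"
    by linarith
  show ?thesis
    unfolding zeckendorf_def digits products total by blast
qed

text \<open>A leading one forces a zero below it, so the remainder drops by two indices and F(n+3) +
  F(n+2) = F(n+4) closes the induction.\<close>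

lemma zeckendorf_less: "zeckendorf (Suc n) u m \<Longrightarrow> m < fib (n + 2)"
proof (induction n arbitrary: m rule: fib.induct)
  case 1
  then show ?case by (simp add: zeckendorf_def)
next
  case 2
  then have "u 2 \<in> {0, 1}" "m = u 2"
    by (simp_all add: zeckendorf_def flip: numeral_2_eq_2)
  then show ?case by auto
next
  case (3 n)
  let ?x = "u (Suc (Suc (Suc n)))"
  have *: "?x \<in> {0, 1}" "u (Suc (Suc n)) * ?x = 0" "?x * fib (n + 3) \<le> m"
    "zeckendorf (Suc (Suc n)) u (m - ?x * fib (n + 3))"
    using "3.prems" by (auto simp: zeckendorf_Suc[of "Suc (Suc n)"] numeral_3_eq_3)
  show ?case
  proof (cases "?x = 0")
    case True
    then have "m < fib (Suc n + 2)"
      using * "3.IH"(1) by simp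
    then show ?thesis
      by simp
  next
    case False
    then have x: "?x = 1" "u (Suc (Suc n)) = 0"
      using * by auto
    then have "zeckendorf (Suc n) u (m - fib (n + 3))"
      using *(4) by (simp add: zeckendorf_Suc[of "Suc n"])
    then have "m - fib (n + 3) < fib (n + 2)"
      by (rule "3.IH"(2))
    then show ?thesis
      using *(3) x by (simp add: numeral_3_eq_3)
  qed
qed

text \<open>The expansion is greedy: the digits below the leading one cannot reach F(n+2), so the
  size of \<open>m\<close> alone decides the leading digit.\<close>

lemma zeckendorf_top_digit:
  assumes "zeckendorf (Suc (Suc n)) u m"
  shows "u (Suc (Suc n)) = (if m < fib (n + 2) then 0 else 1)"
proof -
  have "zeckendorf (Suc n) u (m - u (Suc (Suc n)) * fib (n + 2))"
    "u (Suc (Suc n)) \<in> {0, 1}" "u (Suc (Suc n)) * fib (n + 2) \<le> m"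
    using assms by (auto simp: zeckendorf_Suc[of "Suc n"])
  then show ?thesis
    using zeckendorf_less[of n u m] by auto
qed

lemma zeckendorf_top_zero:
  assumes "zeckendorf (Suc (Suc n)) u m" "m < fib (n + 2)"
  shows "zeckendorf (Suc n) u m"
  using assms(1) zeckendorf_top_digit[OF assms(1)] assms(2)
  by (simp add: zeckendorf_Suc[of "Suc n"])

lemma zeckendorf_top_one:
  assumes "zeckendorf (Suc (Suc (Suc n))) u m" "fib (n + 3) \<le> m"
  shows "zeckendorf (Suc n) u (m - fib (n + 3))" "u (Suc (Suc n)) = 0"
  using assms(1) zeckendorf_top_digit[OF assms(1)] assms(2)
  by (auto simp: zeckendorf_Suc[of "Suc n"] zeckendorf_Suc[of "Suc (Suc n)"] numeral_3_eq_3)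

text \<open>The blocks of W(n+2) = W(n+1) (n+2) W(n) match the leading digits of
  \<open>k - 1\<close> and \<open>k\<close>. Describing \<open>j\<close> by a disagreement with
  agreement above it, instead of by a maximum, lets the same \<open>j\<close> pass to the shorter
  digit ranges.\<close>

lemma transfer_word_nth_Zeckendorf:
  assumes "0 < k" "k < fib (n + 2)" "zeckendorf (Suc n) u (k - 1)" "zeckendorf (Suc n) v k"
    and "j \<in> {2..Suc n}" "u j \<noteq> v j" "\<And>i. j < i \<Longrightarrow> i \<le> Suc n \<Longrightarrow> u i = v i"
  shows "fst (transfer_word n p q ! (k - 1)) = j - 1"
  using assms
proof (induction n p q arbitrary: k rule: transfer_word.induct)
  case (1 p q)
  then show ?case by simp
next
  case (2 p q)
  then have "k = 1" "j = 2"
    by (auto simp: numeral_3_eq_3)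
  then show ?case
    by simp
next
  case (3 n p q)
  let ?y = "third p q" and ?r = "Suc (Suc (Suc n))"
  have len: "Suc (length (transfer_word (Suc n) p ?y)) = fib (n + 3)"
    using length_transfer_word[of "Suc n" p ?y] by (simp add: numeral_3_eq_3)
  have top: "u ?r = (if k - 1 < fib (n + 3) then 0 else 1)"
    "v ?r = (if k < fib (n + 3) then 0 else 1)"
    using zeckendorf_top_digit[OF "3.prems"(3)] zeckendorf_top_digit[OF "3.prems"(4)]
    by (simp_all add: numeral_3_eq_3)
  \<comment> \<open>First block, middle letter, last block: the leading digits of
    \<open>k - 1\<close> and \<open>k\<close> are 0 0, 0 1 and 1 1 respectively.\<close>
  consider "k < fib (n + 3)" | "k = fib (n + 3)" | "fib (n + 3) < k"
    by linarith
  then show ?case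
  proof cases
    case 1
    have "k - 1 < fib (n + 3)"
      using 1 by linarith
    then have "u ?r = v ?r"
      using top 1 by simp
    then have "j \<noteq> ?r"
      using "3.prems"(6) by blast
    moreover have "zeckendorf (Suc (Suc n)) u (k - 1)" "zeckendorf (Suc (Suc n)) v k"
      using 1 "3.prems"(3,4) by (auto intro!: zeckendorf_top_zero simp: numeral_3_eq_3)
    ultimately have "fst (transfer_word (Suc n) p ?y ! (k - 1)) = j - 1"
      using 1 "3.prems" by (intro "3.IH"(1)) (auto simp: numeral_3_eq_3)
    then show ?thesis
      using 1 len "3.prems"(1) by (simp add: nth_append)
  next
    case 2
    have "u ?r \<noteq> v ?r"
      using top 2 "3.prems"(1) by auto
    then have "j = ?r"
      using "3.prems"(5,7) by (metis atLeastAtMost_iff le_neq_implies_less order_refl)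
    moreover have "k - 1 = length (transfer_word (Suc n) p ?y)"
      using 2 len by simp
    ultimately show ?thesis
      by simp
  next
    case 3
    let ?k = "k - fib (n + 3)"
    have u: "zeckendorf (Suc n) u (?k - 1)" "u (Suc (Suc n)) = 0"
      using zeckendorf_top_one[OF "3.prems"(3)] 3 by (auto simp: diff_right_commute)
    have v: "zeckendorf (Suc n) v ?k" "v (Suc (Suc n)) = 0"
      using zeckendorf_top_one[OF "3.prems"(4)] 3 by auto
    have "\<not> k - 1 < fib (n + 3)"
      using 3 by linarith
    then have "u ?r = v ?r"
      using top 3 by simp
    then have "j \<noteq> ?r"
      using "3.prems"(6) by blast
    moreover have "j \<noteq> Suc (Suc n)"
      using u v "3.prems"(6) by auto
    ultimately have "fst (transfer_word n ?y q ! (?k - 1)) = j - 1"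
      using 3 u(1) v(1) "3.prems" by (intro "3.IH"(2)) (auto simp: numeral_3_eq_3)
    \<comment> \<open>The \<open>Suc\<close> skips the middle letter; the first block has F(n+3) - 1
      letters.\<close>
    moreover have "k - 1 = length (transfer_word (Suc n) p ?y) + Suc (?k - 1)"
      using 3 len by linarith
    ultimately show ?thesis
      by (simp only: transfer_word.simps nth_append_length_plus nth_Cons_Suc)
  qed
qed

section \<open>States and configurations\<close>

definition state_of :: "nat \<Rightarrow> config \<Rightarrow> state" where
  "state_of n f p = {d \<in> disks n. f d = p}"

lemma peg_exhaust3:
  fixes X Y Z p :: peg
  assumes "X \<noteq> Y" "X \<noteq> Z" "Y \<noteq> Z"
  shows "p = X \<or> p = Y \<or> p = Z"
  using assms by (cases X; cases Y; cases Z; cases p; simp)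

lemma is_state_state_of: "is_state n (state_of n f)"
  by (auto simp: is_state_def state_of_def)

lemma state_of_eq_all_on: "state_of n f = all_on n p \<longleftrightarrow> tower f n p"
proof
  assume eq: "state_of n f = all_on n p"
  show "tower f n p"
    unfolding tower_def
  proof (intro allI impI)
    fix d
    assume "0 < d \<and> d \<le> n"
    then have "d \<in> state_of n f p"
      unfolding eq by (simp add: all_on_def disks_def)
    then show "f d = p"
      by (simp add: state_of_def)
  qed
next
  assume tw: "tower f n p"
  have "f d = p" if "d \<in> disks n" for d
    using tw that by (simp add: tower_def disks_def)
  then have "state_of n f q = all_on n p q" for q
    unfolding state_of_def all_on_def by auto
  then show "state_of n f = all_on n p"
    by (rule ext)
qed

text \<open>These are the remainders called \<open>X'\<close> and \<open>Y'\<close> in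
  \<open>fib_move\<close>, and the whole of the third peg.\<close>

definition larger_disks :: "nat \<Rightarrow> config \<Rightarrow> nat \<Rightarrow> peg \<Rightarrow> nat set" where
  "larger_disks n f k p = {d. k < d \<and> d \<le> n \<and> f d = p}"

lemma state_of_before_move:
  assumes "0 < k" "k \<le> n" "x \<noteq> y" "x \<noteq> z" "y \<noteq> z" "f k = x" "tower f (k - 1) y"
  shows "state_of n f x = {k} \<union> larger_disks n f k x"
    and "state_of n f y = disks (k - 1) \<union> larger_disks n f k y"
    and "state_of n f z = larger_disks n f k z"
proof -
  have small: "f d = y" if "0 < d" "d < k" for d
    using assms(7) that by (auto simp: tower_def)
  have "(d \<in> state_of n f x \<longleftrightarrow> d \<in> {k} \<union> larger_disks n f k x) \<and>
    (d \<in> state_of n f y \<longleftrightarrow> d \<in> disks (k - 1) \<union> larger_disks n f k y) \<and>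
    (d \<in> state_of n f z \<longleftrightarrow> d \<in> larger_disks n f k z)" for d
  proof -
    consider "d = 0" | "d = k" | "0 < d" "d < k" | "k < d"
      by linarith
    then show ?thesis
      using assms small[of d]
      by cases (auto simp: state_of_def larger_disks_def disks_def)
  qed
  then show "state_of n f x = {k} \<union> larger_disks n f k x"
    "state_of n f y = disks (k - 1) \<union> larger_disks n f k y"
    "state_of n f z = larger_disks n f k z"
    by blast+
qed

lemma state_of_after_move:
  assumes "0 < k" "k \<le> n" "x \<noteq> y" "x \<noteq> z" "y \<noteq> z" "f k = x" "tower f (k - 1) y"
  shows "state_of n (move k z f) = (state_of n f)(x := larger_disks n f k x,
    y := disks (k - 2) \<union> larger_disks n f k y, z := ({k - 1, k} \<inter> disks k) \<union> state_of n f z)"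
    (is "_ = ?t")
proof
  fix p
  have small: "f d = y" if "0 < d" "d < k" for d
    using assms(7) that by (auto simp: tower_def)
  have "d \<in> state_of n (move k z f) p \<longleftrightarrow> d \<in> ?t p" for d
  proof -
    \<comment> \<open>The guard on \<open>d = k - 1\<close> separates it from the dummy disk 0 when
      \<open>k = 1\<close>.\<close>
    consider "d = 0" | "d = k" | "0 < d" "d = k - 1" | "0 < d" "d \<le> k - 2" "d < k - 1" | "k < d"
      by linarith
    then show ?thesis
      using assms peg_exhaust3[of x y z p] small[of d]
      by cases (auto simp: state_of_def move_def larger_disks_def disks_def)
  qed
  then show "state_of n (move k z f) p = ?t p"
    by blast
qed

lemma fib_move_state_of:
  assumes "legal f k z" "k \<le> n"
  shows "fib_move n k (state_of n f) (state_of n (move k z f))"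
proof -
  obtain y where k: "0 < k" and y: "f k \<noteq> y" "f k \<noteq> z" "y \<noteq> z" "tower f (k - 1) y"
    using assms(1) unfolding legal_def by metis
  note eqs = state_of_before_move[OF k assms(2) y(1-3) refl y(4)]
    state_of_after_move[OF k assms(2) y(1-3) refl y(4)]
  have "\<forall>d \<in> larger_disks n f k (f k) \<union> larger_disks n f k y \<union> state_of n f z. k < d"
    unfolding eqs(3) by (auto simp: larger_disks_def)
  moreover have "k \<in> disks n"
    using k assms(2) by (simp add: disks_def)
  ultimately show ?thesis
    unfolding fib_move_def using is_state_state_of y(1-3) eqs(1,2,4) by blast
qed

text \<open>Converse direction: the pegs in a Fibonacci move are read off the configuration, so
  every such move lifts to a move of configurations.\<close>

lemma fib_move_state_ofD:
  assumes "fib_move n k (state_of n f) t"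
  obtains z where "legal f k z" "k \<le> n" "t = state_of n (move k z f)"
proof -
  obtain X Y Z X' Y' where kn: "k \<in> disks n" and ne: "X \<noteq> Y" "X \<noteq> Z" "Y \<noteq> Z"
    and s: "state_of n f X = {k} \<union> X'" "state_of n f Y = disks (k - 1) \<union> Y'"
    and large: "\<forall>d \<in> X' \<union> Y' \<union> state_of n f Z. k < d"
    and t: "t = (state_of n f)(X := X', Y := disks (k - 2) \<union> Y',
      Z := ({k - 1, k} \<inter> disks k) \<union> state_of n f Z)"
    using assms unfolding fib_move_def by blast
  have k: "0 < k" "k \<le> n"
    using kn by (auto simp: disks_def)
  have fk: "f k = X"
    using s(1) by (auto simp: state_of_def)
  have "d \<in> state_of n f Y" if "0 < d" "d \<le> k - 1" for d
    using s(2) that by (auto simp: disks_def)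
  then have tw: "tower f (k - 1) Y"
    by (auto simp: tower_def state_of_def)
  have leg: "legal f k Z"
    using k fk tw ne unfolding legal_def by metis
  \<comment> \<open>All disks of the remainders exceed \<open>k\<close>, which pins them down inside
    their pegs.\<close>
  have "X' = {d \<in> state_of n f X. k < d}" "Y' = {d \<in> state_of n f Y. k < d}"
    using s large by (auto simp: disks_def)
  then have "X' = larger_disks n f k X" "Y' = larger_disks n f k Y"
    by (auto simp: state_of_def larger_disks_def disks_def)
  then have "t = state_of n (move k Z f)"
    using t state_of_after_move[OF k ne fk tw] by simp
  then show thesis
    using that leg k by blast
qed

section \<open>Solutions as trajectories of words\<close>

lemma length_trajectory: "length (trajectory f ms) = Suc (length ms)"
  by (induction f ms rule: trajectory.induct) auto

lemma hd_trajectory: "hd (trajectory f ms) = f"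
  by (induction f ms rule: trajectory.induct) auto

lemma last_trajectory: "last (trajectory f ms) = run f ms"
proof (induction f ms rule: trajectory.induct)
  case (2 f k z ms)
  have "trajectory (move k z f) ms \<noteq> []"
    using length_trajectory[of "move k z f" ms] by auto
  then show ?case
    using 2 by simp
qed simp

lemma fib_move_trajectory:
  "valid n f ms \<Longrightarrow> i < length ms \<Longrightarrow>
    fib_move n (fst (ms ! i)) (state_of n (trajectory f ms ! i))
      (state_of n (trajectory f ms ! Suc i))"
proof (induction n f ms arbitrary: i rule: valid.induct)
  case (2 n f k z ms)
  have "trajectory (move k z f) ms ! 0 = move k z f"
    using hd_trajectory[of "move k z f" ms] length_trajectory[of "move k z f" ms]
    by (metis hd_conv_nth length_0_conv nat.distinct(1))
  then show ?case
    using 2 fib_move_state_of by (cases i) auto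
qed simp

text \<open>Each state is lifted from its predecessor; \<open>f\<close> is generalised because the
  tail starts at the configuration after the first move.\<close>

lemma move_sequence_trajectory:
  assumes "ss \<noteq> []" "hd ss = state_of n f"
    "\<forall>i. Suc i < length ss \<longrightarrow> (\<exists>k. fib_move n k (ss ! i) (ss ! Suc i))"
  shows "\<exists>ms. valid n f ms \<and> ss = map (state_of n) (trajectory f ms)"
  using assms
proof (induction ss arbitrary: f)
  case Nil
  from Nil.prems(1) show ?case
    by simp
next
  case (Cons s ss)
  show ?case
  proof (cases "ss = []")
    case True
    then have "valid n f [] \<and> s # ss = map (state_of n) (trajectory f [])"
      using Cons.prems(2) by simp
    then show ?thesis
      by (rule exI)
  next
    case False
    then have "Suc 0 < length (s # ss)"
      by simp
    then have "\<exists>k. fib_move n k ((s # ss) ! 0) ((s # ss) ! Suc 0)"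
      using Cons.prems(3) by blast
    then obtain k where "fib_move n k (state_of n f) (hd ss)"
      using Cons.prems(2) False by (auto simp: hd_conv_nth)
    then obtain z where z: "legal f k z" "k \<le> n" "hd ss = state_of n (move k z f)"
      by (rule fib_move_state_ofD)
    have "\<forall>i. Suc i < length ss \<longrightarrow> (\<exists>k. fib_move n k (ss ! i) (ss ! Suc i))"
    proof (intro allI impI)
      fix i
      assume "Suc i < length ss"
      then show "\<exists>k. fib_move n k (ss ! i) (ss ! Suc i)"
        using spec[OF Cons.prems(3), of "Suc i"] by simp
    qed
    then obtain ms where "valid n (move k z f) ms"
      "ss = map (state_of n) (trajectory (move k z f) ms)"
      using Cons.IH[OF False z(3)] by blast
    then have "valid n f ((k, z) # ms) \<and> s # ss = map (state_of n) (trajectory f ((k, z) # ms))"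
      using z Cons.prems(2) by simp
    then show ?thesis
      by (rule exI)
  qed
qed

lemma solution_iff_trajectory:
  "solution n ss \<longleftrightarrow> (\<exists>ms. valid n (\<lambda>_. Peg_A) ms \<and> tower (run (\<lambda>_. Peg_A) ms) n Peg_C \<and>
     ss = map (state_of n) (trajectory (\<lambda>_. Peg_A) ms))"
    (is "_ \<longleftrightarrow> (\<exists>ms. ?P ms)")
proof -
  let ?f = "\<lambda>_::nat. Peg_A"
  have start: "state_of n ?f = all_on n Peg_A"
    by (simp add: state_of_eq_all_on tower_def)
  have nonempty: "trajectory ?f ms \<noteq> []" for ms
    using length_trajectory[of ?f ms] by auto
  show ?thesis
  proof
    assume sol: "solution n ss"
    then obtain ms where ms: "valid n ?f ms" "ss = map (state_of n) (trajectory ?f ms)"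
      using move_sequence_trajectory[of ss n ?f] start unfolding solution_def by metis
    have "last ss = all_on n Peg_C"
      using sol unfolding solution_def by blast
    then have "state_of n (run ?f ms) = all_on n Peg_C"
      using ms(2) nonempty by (simp add: last_map last_trajectory)
    then show "\<exists>ms. ?P ms"
      using ms state_of_eq_all_on by blast
  next
    assume "\<exists>ms. ?P ms"
    then obtain ms where ms: "valid n ?f ms" "tower (run ?f ms) n Peg_C"
      "ss = map (state_of n) (trajectory ?f ms)"
      by blast
    have "\<exists>k. fib_move n k (ss ! i) (ss ! Suc i)" if "Suc i < length ss" for i
    proof -
      have "i < length ms"
        using that ms(3) by (simp add: length_trajectory)
      from fib_move_trajectory[OF ms(1) this] show ?thesis
        using that unfolding ms(3) by (intro exI) simp
    qed
    moreover have "ss \<noteq> []" "hd ss = all_on n Peg_A" "last ss = all_on n Peg_C"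
      using ms(2,3) nonempty start state_of_eq_all_on[of n "run ?f ms" Peg_C]
      by (simp_all add: hd_map hd_trajectory last_map last_trajectory)
    ultimately show "solution n ss"
      unfolding solution_def by blast
  qed
qed

text \<open>The lower bound and uniqueness for words carry over to lists of states, whose minimal
  length is F(n+2) because the initial state is counted.\<close>

lemma optimal_solution_iff:
  "optimal_solution n ss \<longleftrightarrow>
     ss = map (state_of n) (trajectory (\<lambda>_. Peg_A) (transfer_word n Peg_A Peg_C))"
    (is "_ \<longleftrightarrow> ss = ?opt")
proof -
  let ?f = "\<lambda>_::nat. Peg_A"
  have start: "tower ?f n Peg_A"
    by (simp add: tower_def)
  have opt: "solution n ?opt"
    using transfer_word_correct[of Peg_A Peg_C ?f n] start by (auto simp: solution_iff_trajectory)
  have len: "length ?opt = fib (n + 2)"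
    using length_transfer_word[of n Peg_A Peg_C] by (simp add: length_trajectory)
  have bound: "fib (n + 2) \<le> length ts \<and> (length ts = fib (n + 2) \<longrightarrow> ts = ?opt)"
    if sol: "solution n ts" for ts
  proof -
    obtain ms where ms: "valid n ?f ms" "tower (run ?f ms) n Peg_C"
      "ts = map (state_of n) (trajectory ?f ms)"
      using sol solution_iff_trajectory by blast
    then show ?thesis
      using transfer_word_optimal[OF ms(1) start ms(2)] by (simp add: length_trajectory)
  qed
  show ?thesis
    using opt len bound unfolding optimal_solution_def by (metis le_antisym)
qed

theorem theorem2p3:
  fixes n k j :: nat and u v :: "nat \<Rightarrow> nat"
  assumes "0 < k" and "k < fib (n + 2)"
    and "zeckendorf (n + 1) u (k - 1)"
    and "zeckendorf (n + 1) v k"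
    and "j = Max {i \<in> {2..n + 1}. u i \<noteq> v i}"
  shows "(\<exists>!ss. optimal_solution n ss) \<and>
    (\<forall>ss. optimal_solution n ss \<longrightarrow>
       k < length ss \<and> fib_move n (j - 1) (ss ! (k - 1)) (ss ! k))"
proof -
  let ?f = "\<lambda>_::nat. Peg_A" and ?w = "transfer_word n Peg_A Peg_C"
  let ?D = "{i \<in> {2..n + 1}. u i \<noteq> v i}" and ?opt = "map (state_of n) (trajectory ?f ?w)"
  \<comment> \<open>Without a disagreement the two expansions would have equal sums; this makes
    \<open>Max\<close> meaningful.\<close>
  have "?D \<noteq> {}"
  proof
    assume "?D = {}"
    then have "(\<Sum>i = 2..n + 1. u i * fib i) = (\<Sum>i = 2..n + 1. v i * fib i)"
      by (intro sum.cong) auto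
    then have "k - 1 = k"
      using assms(3,4) unfolding zeckendorf_def by argo
    then show False
      using assms(1) by simp
  qed
  then have j: "j \<in> ?D"
    using Max_in[of ?D] assms(5) by simp
  have same: "u i = v i" if "j < i" "i \<le> Suc n" for i
    using Max_ge[of ?D i] that j assms(5) by fastforce
  have letter: "fst (?w ! (k - 1)) = j - 1"
    using assms(1-4) j same by (intro transfer_word_nth_Zeckendorf[where u = u and v = v]) auto
  have len: "k < Suc (length ?w)"
    using length_transfer_word[of n Peg_A Peg_C] assms(2) by simp
  have "valid n ?f ?w"
    using transfer_word_correct[of Peg_A Peg_C ?f n] by (simp add: tower_def)
  \<comment> \<open>Positions count from 0, so the \<open>k\<close>-th letter has position
    \<open>k - 1\<close> and leads to state \<open>k\<close>.\<close>
  then have "fib_move n (j - 1) (?opt ! (k - 1)) (?opt ! k)"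
    using fib_move_trajectory[of n ?f ?w "k - 1"] len assms(1) letter
    by (simp add: length_trajectory)
  then show ?thesis
    using len by (auto simp: optimal_solution_iff length_trajectory)
qed

end
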